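(* Let $\{(R_n,\mathfrak m_n)\}_{n\ge 0}$ be an infinite family of Noetherian local domains such that $R_n$ is a subring of $R_{n+1}$ for each integer $n\ge 0$. Assume that $\operatorname{ord}_{R_n}$ defines a valuation for each integer $n\ge 0$, and that $\bigcup_{n=0}^{\infty}R_n=V$ is a rank one valuation domain. Let $v$ be a (real-valued) valuation associated to $V$, and let $f,g$ be nonzero elements of the maximal ideal of $V$. Then for all sufficiently large $n$ the elements $f$ and $g$ are in $\mathfrak m_n$, and $$\frac{v(f)}{v(g)}=\lim_{n\to\infty}\frac{\operatorname{ord}_{R_n}(f)}{\operatorname{ord}_{R_n}(g)}.$$
   Context: For a Noetherian local domain $(A,\mathfrak n)$ and a nonzero $a\in A$, $\operatorname{ord}_A(a)$ is the integer $r\ge 0$ with $a\in\mathfrak n^r\setminus\mathfrak n^{r+1}$. Saying that $\operatorname{ord}_A$ defines a valuation means that $a/b\mapsto \operatorname{ord}_A(a)-\operatorname{ord}_A(b)$ (for nonzero $a,b\in A$) is a well-defined valuation on the field of fractions of $A$. The rank of a valuation domain is its Krull dimension; a rank one valuation domain has an associated valuation with values in $\mathbb R$. *)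

theory Defs
  imports Complex_Main "HOL-Algebra.Algebra" "HOL-Library.Extended_Nat"
begin

section \<open>Local rings and the order function\<close>

locale local_ring = cring +
  assumes unique_maximalideal: "\<exists>!M. maximalideal M R"

definition max_ideal :: "('a, 'b) ring_scheme \<Rightarrow> 'a set" where
  "max_ideal A = (THE M. maximalideal M A)"

locale noetherian_local_domain = noetherian_domain + local_ring

text \<open>Powers of ideals are taken in the library's multiplicative monoid of ideals, so the zeroth
  power is the whole ring. In a Noetherian local domain the \<open>r\<close> below exists and is unique for every
  nonzero \<open>a\<close> (Krull's intersection theorem); for other arguments the value is unspecified.\<close>

definition ord_at :: "('a, 'b) ring_scheme \<Rightarrow> 'a \<Rightarrow> nat" where
  "ord_at A a = (THE r. a \<in> max_ideal A [^]\<^bsub>ideals_set A\<^esub> r \<and>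
                        a \<notin> max_ideal A [^]\<^bsub>ideals_set A\<^esub> Suc r)"


section \<open>The field of fractions of a domain\<close>

definition frac_rel :: "('a, 'b) ring_scheme \<Rightarrow> (('a \<times> 'a) \<times> ('a \<times> 'a)) set" where
  "frac_rel A = {((a, b), (c, d)). a \<in> carrier A \<and> c \<in> carrier A \<and>
      b \<in> carrier A - {\<zero>\<^bsub>A\<^esub>} \<and> d \<in> carrier A - {\<zero>\<^bsub>A\<^esub>} \<and> a \<otimes>\<^bsub>A\<^esub> d = c \<otimes>\<^bsub>A\<^esub> b}"

definition fraction :: "('a, 'b) ring_scheme \<Rightarrow> 'a \<Rightarrow> 'a \<Rightarrow> ('a \<times> 'a) set" where
  "fraction A a b = frac_rel A `` {(a, b)}"

text \<open>The unions below are over all representatives; for a domain they all yield the same class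
  (see \<open>frac_mult\<close> and \<open>frac_add\<close>).\<close>

definition frac_field :: "('a, 'b) ring_scheme \<Rightarrow> ('a \<times> 'a) set ring" where
  "frac_field A =
    \<lparr> carrier = {fraction A a b | a b. a \<in> carrier A \<and> b \<in> carrier A - {\<zero>\<^bsub>A\<^esub>}},
      monoid.mult = (\<lambda>S T. \<Union>p\<in>S. \<Union>q\<in>T.
               fraction A (fst p \<otimes>\<^bsub>A\<^esub> fst q) (snd p \<otimes>\<^bsub>A\<^esub> snd q)),
      one = fraction A \<one>\<^bsub>A\<^esub> \<one>\<^bsub>A\<^esub>,
      ring.zero = fraction A \<zero>\<^bsub>A\<^esub> \<one>\<^bsub>A\<^esub>,
      ring.add = (\<lambda>S T. \<Union>p\<in>S. \<Union>q\<in>T.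
               fraction A (fst p \<otimes>\<^bsub>A\<^esub> snd q \<oplus>\<^bsub>A\<^esub> fst q \<otimes>\<^bsub>A\<^esub> snd p)
                 (snd p \<otimes>\<^bsub>A\<^esub> snd q)) \<rparr>"

definition frac_embed :: "('a, 'b) ring_scheme \<Rightarrow> 'a \<Rightarrow> ('a \<times> 'a) set" where
  "frac_embed A a = fraction A a \<one>\<^bsub>A\<^esub>"

lemma UN2_eq_const:
  assumes "\<And>p q. p \<in> S \<Longrightarrow> q \<in> T \<Longrightarrow> F p q = C" "p0 \<in> S" "q0 \<in> T"
  shows "(\<Union>p\<in>S. \<Union>q\<in>T. F p q) = C"
proof -
  have "(\<Union>q\<in>T. F p q) = C" if "p \<in> S" for p
    using assms that by blast
  then show ?thesis
    using assms by blast
qed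

context domain
begin

lemma equiv_frac_rel: "equiv (carrier R \<times> (carrier R - {\<zero>})) (frac_rel R)"
proof (rule equivI)
  show "frac_rel R \<subseteq> (carrier R \<times> (carrier R - {\<zero>})) \<times> (carrier R \<times> (carrier R - {\<zero>}))"
    by (auto simp: frac_rel_def)
  show "refl_on (carrier R \<times> (carrier R - {\<zero>})) (frac_rel R)"
    by (auto simp: refl_on_def frac_rel_def)
  show "sym (frac_rel R)"
    by (auto simp: sym_def frac_rel_def)
  show "trans (frac_rel R)"
  proof (rule transI, clarify)
    fix a b c d e f
    assume *: "((a, b), (c, d)) \<in> frac_rel R" "((c, d), (e, f)) \<in> frac_rel R"
    then have car: "a \<in> carrier R" "b \<in> carrier R" "c \<in> carrier R" "d \<in> carrier R"
        "e \<in> carrier R" "f \<in> carrier R" and nz: "d \<noteq> \<zero>"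
      and eq: "a \<otimes> d = c \<otimes> b" "c \<otimes> f = e \<otimes> d"
      by (auto simp: frac_rel_def)
    have "d \<otimes> (a \<otimes> f) = (a \<otimes> d) \<otimes> f" using car by (simp add: m_ac)
    also have "\<dots> = b \<otimes> (c \<otimes> f)" unfolding eq(1) using car by (simp add: m_ac)
    also have "\<dots> = d \<otimes> (e \<otimes> b)" unfolding eq(2) using car by (simp add: m_ac)
    finally have "a \<otimes> f = e \<otimes> b" using car nz by (simp add: m_lcancel)
    then show "((a, b), (e, f)) \<in> frac_rel R" using * by (auto simp: frac_rel_def)
  qed
qed

lemma frac_eq_iff:
  assumes "a \<in> carrier R" "b \<in> carrier R - {\<zero>}" "c \<in> carrier R" "d \<in> carrier R - {\<zero>}"
  shows "fraction R a b = fraction R c d \<longleftrightarrow> a \<otimes> d = c \<otimes> b"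
  unfolding fraction_def
  using eq_equiv_class_iff[OF equiv_frac_rel, of "(a, b)" "(c, d)"] assms
  by (simp add: frac_rel_def)

lemma mem_frac_iff:
  assumes "a \<in> carrier R" "b \<in> carrier R - {\<zero>}"
  shows "(c, d) \<in> fraction R a b \<longleftrightarrow>
    c \<in> carrier R \<and> d \<in> carrier R - {\<zero>} \<and> fraction R c d = fraction R a b"
proof -
  have "(c, d) \<in> fraction R a b \<longleftrightarrow> c \<in> carrier R \<and> d \<in> carrier R - {\<zero>} \<and> a \<otimes> d = c \<otimes> b"
    using assms by (auto simp: fraction_def frac_rel_def)
  then show ?thesis
    using assms frac_eq_iff[of c d a b] by auto
qed

lemma frac_mult:
  assumes "a \<in> carrier R" "b \<in> carrier R - {\<zero>}" "c \<in> carrier R" "d \<in> carrier R - {\<zero>}"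
  shows "fraction R a b \<otimes>\<^bsub>frac_field R\<^esub> fraction R c d = fraction R (a \<otimes> c) (b \<otimes> d)"
proof -
  have const: "fraction R (a' \<otimes> c') (b' \<otimes> d') = fraction R (a \<otimes> c) (b \<otimes> d)"
    if "(a', b') \<in> fraction R a b" "(c', d') \<in> fraction R c d" for a' b' c' d'
  proof -
    have car: "a' \<in> carrier R" "b' \<in> carrier R - {\<zero>}" "c' \<in> carrier R" "d' \<in> carrier R - {\<zero>}"
      and eq: "a' \<otimes> b = a \<otimes> b'" "c' \<otimes> d = c \<otimes> d'"
      using that assms frac_eq_iff by (auto simp: mem_frac_iff)
    have "(a' \<otimes> c') \<otimes> (b \<otimes> d) = (a' \<otimes> b) \<otimes> (c' \<otimes> d)"
      using car assms by (simp add: m_ac)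
    also have "\<dots> = (a \<otimes> c) \<otimes> (b' \<otimes> d')"
      unfolding eq using car assms by (simp add: m_ac)
    finally show ?thesis
      using car assms by (subst frac_eq_iff) (auto simp: integral_iff)
  qed
  have mem: "(a, b) \<in> fraction R a b" "(c, d) \<in> fraction R c d"
    using assms by (auto simp: mem_frac_iff)
  show ?thesis
    by (simp add: frac_field_def) (rule UN2_eq_const[OF const mem]; simp)
qed

lemma frac_add:
  assumes "a \<in> carrier R" "b \<in> carrier R - {\<zero>}" "c \<in> carrier R" "d \<in> carrier R - {\<zero>}"
  shows "fraction R a b \<oplus>\<^bsub>frac_field R\<^esub> fraction R c d = fraction R (a \<otimes> d \<oplus> c \<otimes> b) (b \<otimes> d)"
proof -
  have const: "fraction R (a' \<otimes> d' \<oplus> c' \<otimes> b') (b' \<otimes> d') = fraction R (a \<otimes> d \<oplus> c \<otimes> b) (b \<otimes> d)"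
    if "(a', b') \<in> fraction R a b" "(c', d') \<in> fraction R c d" for a' b' c' d'
  proof -
    have car: "a' \<in> carrier R" "b' \<in> carrier R - {\<zero>}" "c' \<in> carrier R" "d' \<in> carrier R - {\<zero>}"
      and eq: "a' \<otimes> b = a \<otimes> b'" "c' \<otimes> d = c \<otimes> d'"
      using that assms frac_eq_iff by (auto simp: mem_frac_iff)
    have "(a' \<otimes> d' \<oplus> c' \<otimes> b') \<otimes> (b \<otimes> d)
        = (a' \<otimes> b) \<otimes> (d \<otimes> d') \<oplus> (c' \<otimes> d) \<otimes> (b \<otimes> b')"
      using car assms by (simp add: l_distr r_distr m_ac)
    also have "\<dots> = (a \<otimes> d \<oplus> c \<otimes> b) \<otimes> (b' \<otimes> d')"
      unfolding eq using car assms by (simp add: l_distr r_distr m_ac)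
    finally show ?thesis
      using car assms by (subst frac_eq_iff) (auto simp: integral_iff)
  qed
  have mem: "(a, b) \<in> fraction R a b" "(c, d) \<in> fraction R c d"
    using assms by (auto simp: mem_frac_iff)
  show ?thesis
    by (simp add: frac_field_def) (rule UN2_eq_const[OF const mem]; simp)
qed

lemma frac_fieldE:
  assumes "x \<in> carrier (frac_field R)"
  obtains a b where "a \<in> carrier R" "b \<in> carrier R" "b \<noteq> \<zero>" "x = fraction R a b"
  using assms by (auto simp: frac_field_def)

lemma frac_closed:
  "a \<in> carrier R \<Longrightarrow> b \<in> carrier R - {\<zero>} \<Longrightarrow> fraction R a b \<in> carrier (frac_field R)"
  by (auto simp: frac_field_def)

lemma frac_zero: "\<zero>\<^bsub>frac_field R\<^esub> = fraction R \<zero> \<one>"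
  and frac_one: "\<one>\<^bsub>frac_field R\<^esub> = fraction R \<one> \<one>"
  by (simp_all add: frac_field_def)

lemmas frac_simps = frac_mult frac_add frac_zero frac_one frac_closed frac_eq_iff integral_iff

lemma cring_frac_field: "cring (frac_field R)"
proof (intro cringI abelian_groupI comm_monoidI)
  fix x y z
  assume "x \<in> carrier (frac_field R)"
  then obtain a b where [simp]: "a \<in> carrier R" "b \<in> carrier R" "b \<noteq> \<zero>"
    and x: "x = fraction R a b" by (rule frac_fieldE)
  assume "y \<in> carrier (frac_field R)"
  then obtain c d where [simp]: "c \<in> carrier R" "d \<in> carrier R" "d \<noteq> \<zero>"
    and y: "y = fraction R c d" by (rule frac_fieldE)
  show "x \<oplus>\<^bsub>frac_field R\<^esub> y \<in> carrier (frac_field R)"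
    "x \<otimes>\<^bsub>frac_field R\<^esub> y \<in> carrier (frac_field R)"
    unfolding x y by (simp_all add: frac_simps)
  show "x \<oplus>\<^bsub>frac_field R\<^esub> y = y \<oplus>\<^bsub>frac_field R\<^esub> x"
    unfolding x y by (simp add: frac_simps l_distr r_distr m_ac a_ac)
  show "x \<otimes>\<^bsub>frac_field R\<^esub> y = y \<otimes>\<^bsub>frac_field R\<^esub> x"
    unfolding x y by (simp add: frac_simps l_distr r_distr m_ac a_ac)
  assume "z \<in> carrier (frac_field R)"
  then obtain e f where [simp]: "e \<in> carrier R" "f \<in> carrier R" "f \<noteq> \<zero>"
    and z: "z = fraction R e f" by (rule frac_fieldE)
  show "(x \<oplus>\<^bsub>frac_field R\<^esub> y) \<oplus>\<^bsub>frac_field R\<^esub> z = x \<oplus>\<^bsub>frac_field R\<^esub> (y \<oplus>\<^bsub>frac_field R\<^esub> z)"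
    unfolding x y z by (simp add: frac_simps l_distr r_distr m_ac a_ac)
  show "(x \<otimes>\<^bsub>frac_field R\<^esub> y) \<otimes>\<^bsub>frac_field R\<^esub> z = x \<otimes>\<^bsub>frac_field R\<^esub> (y \<otimes>\<^bsub>frac_field R\<^esub> z)"
    unfolding x y z by (simp add: frac_simps l_distr r_distr m_ac a_ac)
  show "(x \<oplus>\<^bsub>frac_field R\<^esub> y) \<otimes>\<^bsub>frac_field R\<^esub> z
      = x \<otimes>\<^bsub>frac_field R\<^esub> z \<oplus>\<^bsub>frac_field R\<^esub> y \<otimes>\<^bsub>frac_field R\<^esub> z"
    unfolding x y z by (simp add: frac_simps l_distr r_distr m_ac a_ac)
next
  fix x assume "x \<in> carrier (frac_field R)"
  then obtain a b where [simp]: "a \<in> carrier R" "b \<in> carrier R" "b \<noteq> \<zero>" and x: "x = fraction R a b"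
    by (rule frac_fieldE)
  show "\<zero>\<^bsub>frac_field R\<^esub> \<oplus>\<^bsub>frac_field R\<^esub> x = x" "\<one>\<^bsub>frac_field R\<^esub> \<otimes>\<^bsub>frac_field R\<^esub> x = x"
    unfolding x by (simp_all add: frac_simps)
  have "fraction R (\<ominus> a) b \<oplus>\<^bsub>frac_field R\<^esub> x = \<zero>\<^bsub>frac_field R\<^esub>"
    unfolding x by (simp add: frac_simps l_minus l_neg)
  then show "\<exists>y\<in>carrier (frac_field R). y \<oplus>\<^bsub>frac_field R\<^esub> x = \<zero>\<^bsub>frac_field R\<^esub>"
    using frac_closed[of "\<ominus> a" b] by auto
qed (simp_all add: frac_simps)

lemma field_frac_field: "field (frac_field R)"
proof (rule cring.cring_fieldI2[OF cring_frac_field])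
  show "\<zero>\<^bsub>frac_field R\<^esub> \<noteq> \<one>\<^bsub>frac_field R\<^esub>"
    by (simp add: frac_simps)
  fix x assume "x \<in> carrier (frac_field R)" and nz: "x \<noteq> \<zero>\<^bsub>frac_field R\<^esub>"
  then obtain a b where x: "a \<in> carrier R" "b \<in> carrier R - {\<zero>}" "x = fraction R a b"
    by (elim frac_fieldE) auto
  with nz have "a \<noteq> \<zero>" by (auto simp: frac_simps)
  then have "x \<otimes>\<^bsub>frac_field R\<^esub> fraction R b a = \<one>\<^bsub>frac_field R\<^esub>"
      "fraction R b a \<in> carrier (frac_field R)"
    using x by (simp_all add: frac_simps m_comm)
  then show "\<exists>y\<in>carrier (frac_field R). x \<otimes>\<^bsub>frac_field R\<^esub> y = \<one>\<^bsub>frac_field R\<^esub>" by blast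
qed

end


section \<open>Valuations and valuation domains\<close>

text \<open>A valuation is only constrained on the nonzero elements; its value at zero
  (conventionally \<open>\<infinity>\<close>) is unspecified.\<close>

definition valuation ::
  "('k, 'm) ring_scheme \<Rightarrow> ('k \<Rightarrow> 'g::linordered_ab_group_add) \<Rightarrow> bool" where
  "valuation K v \<longleftrightarrow>
    (\<forall>x \<in> carrier K - {\<zero>\<^bsub>K\<^esub>}. \<forall>y \<in> carrier K - {\<zero>\<^bsub>K\<^esub>}.
       v (x \<otimes>\<^bsub>K\<^esub> y) = v x + v y \<and>
       (x \<oplus>\<^bsub>K\<^esub> y \<noteq> \<zero>\<^bsub>K\<^esub> \<longrightarrow> min (v x) (v y) \<le> v (x \<oplus>\<^bsub>K\<^esub> y)))"

definition valuation_ring_of ::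
  "('k, 'm) ring_scheme \<Rightarrow> ('k \<Rightarrow> 'g::linordered_ab_group_add) \<Rightarrow> 'k set" where
  "valuation_ring_of K v = {x \<in> carrier K. x = \<zero>\<^bsub>K\<^esub> \<or> 0 \<le> v x}"

text \<open>Well-definedness of \<open>a/b \<mapsto> ord a - ord b\<close> is the existence of a function \<open>w\<close> on fractions
  taking these values.\<close>

definition ord_defines_valuation :: "('a, 'b) ring_scheme \<Rightarrow> bool" where
  "ord_defines_valuation A \<longleftrightarrow>
    (\<exists>w :: ('a \<times> 'a) set \<Rightarrow> int. valuation (frac_field A) w \<and>
      (\<forall>a \<in> carrier A - {\<zero>\<^bsub>A\<^esub>}. \<forall>b \<in> carrier A - {\<zero>\<^bsub>A\<^esub>}.
         w (fraction A a b) = int (ord_at A a) - int (ord_at A b)))"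

locale valuation_domain = domain +
  assumes mem_or_inv_mem:
    "x \<in> carrier (frac_field R) - {\<zero>\<^bsub>frac_field R\<^esub>} \<Longrightarrow>
       x \<in> frac_embed R ` carrier R \<or> inv\<^bsub>frac_field R\<^esub> x \<in> frac_embed R ` carrier R"

definition associated_valuation ::
  "('a, 'b) ring_scheme \<Rightarrow> (('a \<times> 'a) set \<Rightarrow> 'g::linordered_ab_group_add) \<Rightarrow> bool" where
  "associated_valuation V v \<longleftrightarrow>
    valuation (frac_field V) v \<and>
    valuation_ring_of (frac_field V) v = frac_embed V ` carrier V"

definition krull_dim :: "('a, 'b) ring_scheme \<Rightarrow> enat" where
  "krull_dim A = Sup {enat n | n.
     \<exists>P. (\<forall>i\<le>n. primeideal (P i) A) \<and> (\<forall>i<n. P i \<subset> P (Suc i))}"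

end

theory Submission
  imports Defs
begin

text \<open>
  The values of \<open>v\<close> and of the orders are tied together by divisibility. Let \<open>p\<close>, \<open>q\<close> be natural
  numbers with \<open>p v(y) \<le> q v(x)\<close> for nonzero \<open>x\<close>, \<open>y\<close> in \<open>V\<close>. Then \<open>x^q / y^p\<close> has nonnegative
  value, so \<open>x^q = h y^p\<close> for some \<open>h\<close> in \<open>V\<close>. The three elements \<open>x\<close>, \<open>y\<close>, \<open>h\<close> lie in all \<open>R n\<close>
  with \<open>n\<close> large, where the order is additive and nonnegative, whence
  \<open>p ord(y) \<le> q ord(x)\<close>. Taking \<open>(x, y)\<close> to be \<open>(f, g)\<close> and \<open>(g, f)\<close> shows that every rational
  number on one side of \<open>v(f) / v(g)\<close> is eventually on the same side of \<open>ord(f) / ord(g)\<close>, at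
  least weakly; as the rationals are dense, this is the limit
  (\<open>tendsto_if_rational_comparisons\<close>).

  The quotients make sense because \<open>g\<close> has positive value (\<open>valuation_pos_on_max_ideal\<close>) and
  eventually positive order. For the latter, an element that is not invertible in \<open>V\<close> is not
  invertible in any \<open>R n\<close> either, hence lies in the maximal ideal of \<open>R n\<close> as soon as it lies in
  \<open>R n\<close>. That a nonzero element of the maximal ideal \<open>m\<close> has a genuine positive order amounts to
  the intersection of the powers of \<open>m\<close> being zero. Krull's intersection theorem gives this in
  general; when the order defines a valuation, it follows already from \<open>m \<noteq> m\<^sup>2\<close>, that is, from
  Nakayama's lemma (\<open>max_ideal_not_idempotent\<close>, \<open>ord_at_pos\<close>).
\<close>


section \<open>Noetherian local rings\<close>

text \<open>The maximal condition, as the ascending chain condition combined with Zorn's lemma: the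
  union of a nonempty chain of ideals belongs to the chain, and so bounds it inside the
  family.\<close>

lemma (in noetherian_ring) ideal_family_has_maximal:
  assumes "S \<noteq> {}" "\<And>I. I \<in> S \<Longrightarrow> ideal I R"
  shows "\<exists>M\<in>S. \<forall>I\<in>S. M \<subseteq> I \<longrightarrow> I = M"
proof (rule subset_Zorn)
  fix C assume C: "subset.chain S C"
  show "\<exists>U\<in>S. \<forall>I\<in>C. I \<subseteq> U"
  proof (cases "C = {}")
    case True
    then show ?thesis using assms(1) by auto
  next
    case False
    have "subset.chain {I. ideal I R} C"
      using C assms(2) by (auto simp: pred_on.chain_def)
    then have "\<Union>C \<in> C" using False ideal_chain_is_trivial by blast
    then show ?thesis using C by (auto simp: pred_on.chain_def)
  qed
qed

lemma (in local_ring) maximalideal_max_ideal: "maximalideal (max_ideal R) R"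
  unfolding max_ideal_def by (rule theI') (rule unique_maximalideal)

lemma (in local_ring) maximalideal_eq_max_ideal: "maximalideal M R \<Longrightarrow> M = max_ideal R"
  using maximalideal_max_ideal unique_maximalideal by blast

lemma (in domain) pow_nonzero: "a \<in> carrier R \<Longrightarrow> a \<noteq> \<zero> \<Longrightarrow> a [^] (n::nat) \<noteq> \<zero>"
  by (induction n) (auto simp: integral_iff)

context noetherian_local_domain
begin

text \<open>A nonunit generates a proper ideal. An ideal that is maximal among those containing the
  element but not \<open>\<one>\<close> is a maximal ideal of the ring, and there is only one of these.\<close>

lemma nonunit_in_max_ideal:
  assumes a: "a \<in> carrier R" "a \<notin> Units R"
  shows "a \<in> max_ideal R"
proof -
  let ?S = "{I. ideal I R \<and> a \<in> I \<and> \<one> \<notin> I}"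
  have "\<one> \<notin> PIdl a"
    using a m_comm by (auto simp: cgenideal_def Units_def)
  then have "PIdl a \<in> ?S"
    using a cgenideal_ideal cgenideal_self by auto
  then have "\<exists>M\<in>?S. \<forall>I\<in>?S. M \<subseteq> I \<longrightarrow> I = M"
    by (intro ideal_family_has_maximal) auto
  then obtain M where M: "ideal M R" "a \<in> M" "\<one> \<notin> M"
    and max: "\<And>I. I \<in> ?S \<Longrightarrow> M \<subseteq> I \<Longrightarrow> I = M"
    by auto
  have "maximalideal M R"
  proof (rule maximalidealI)
    show "ideal M R" by fact
    show "carrier R \<noteq> M" using M(3) by auto
    fix J assume J: "ideal J R" "M \<subseteq> J" "J \<subseteq> carrier R"
    show "J = M \<or> J = carrier R"
      using max[of J] J M(2) ideal.one_imp_carrier[OF J(1)] by blast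
  qed
  then show ?thesis using maximalideal_eq_max_ideal M(2) by blast
qed

lemma ideal_max_ideal: "ideal (max_ideal R) R"
  using maximalideal_max_ideal by (rule maximalideal.axioms(1))

lemma max_ideal_sub: "max_ideal R \<subseteq> carrier R"
  using ideal.Icarr[OF ideal_max_ideal] by blast

lemma one_notin_max_ideal: "\<one> \<notin> max_ideal R"
  using ideal.one_imp_carrier[OF ideal_max_ideal]
    maximalideal.I_notcarr[OF maximalideal_max_ideal] by blast

text \<open>Nakayama's lemma for \<open>m = m\<^sup>2\<close>. If \<open>m \<noteq> 0\<close>, choose an ideal \<open>I\<close> maximal among those strictly
  inside \<open>m\<close>, and \<open>a\<close> in \<open>m\<close> but not in \<open>I\<close>. Then \<open>m = I + (a)\<close>, so \<open>m\<^sup>2\<close> is contained in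
  \<open>I + m a\<close>. If \<open>m = m\<^sup>2\<close>, then \<open>a = i + c a\<close> with \<open>i\<close> in \<open>I\<close> and \<open>c\<close> in \<open>m\<close>; as \<open>1 - c\<close> is a
  unit, this puts \<open>a\<close> into \<open>I\<close>. The choice of \<open>I\<close> reduces the usual argument with a minimal
  generating set to a single generator.\<close>

lemma max_ideal_not_idempotent:
  assumes "max_ideal R \<noteq> {\<zero>}"
  obtains t where "t \<in> max_ideal R" "t \<notin> max_ideal R \<cdot> max_ideal R"
proof -
  let ?m = "max_ideal R"
  interpret m: ideal ?m R by (rule ideal_max_ideal)
  have False if sub: "?m \<subseteq> ?m \<cdot> ?m"
  proof -
    let ?S = "{I. ideal I R \<and> I \<subset> ?m}"
    have "{\<zero>} \<in> ?S" using assms m.zero_closed zeroideal by auto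
    then have "\<exists>I\<in>?S. \<forall>J\<in>?S. I \<subseteq> J \<longrightarrow> J = I"
      by (intro ideal_family_has_maximal) auto
    then obtain I where I: "ideal I R" "I \<subset> ?m"
      and max: "\<And>J. J \<in> ?S \<Longrightarrow> I \<subseteq> J \<Longrightarrow> J = I"
      by auto
    interpret I: ideal I R by fact
    obtain a where a: "a \<in> ?m" "a \<notin> I" using I by blast
    have ac: "a \<in> carrier R" using a m.Icarr by blast
    let ?J = "I <+>\<^bsub>R\<^esub> PIdl a"
    have Jid: "ideal ?J R" using I(1) ac by (simp add: add_ideals cgenideal_ideal)
    have IJ: "I \<subseteq> ?J"
    proof
      fix x assume x: "x \<in> I"
      have "\<zero> \<in> PIdl a" 
        by (rule additive_subgroup.zero_closed[OF ideal.axioms(1)[OF cgenideal_ideal[OF ac]]])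
      then have "x \<oplus> \<zero> \<in> ?J" using x unfolding set_add_def' by blast
      then show "x \<in> ?J" using x I.Icarr by simp
    qed
    have "\<zero> \<oplus> a \<in> ?J"
      using I.zero_closed cgenideal_self[OF ac] unfolding set_add_def' by blast
    then have "a \<in> ?J" using ac by simp
    moreover have "?J \<subseteq> ?m"
      using I(2) a m.I_l_closed by (auto simp: set_add_def' cgenideal_def)
    ultimately have Jm: "?J = ?m" using max[of ?J] Jid IJ a by blast
    have "\<exists>i\<in>I. \<exists>c\<in>?m. s = i \<oplus> c \<otimes> a" if "s \<in> ?m \<cdot> ?m" for s
      using that
    proof induction
      case (prod x y)
      have "y \<in> ?J" using prod(2) by (simp only: Jm)
      then obtain i r where ir: "i \<in> I" "r \<in> carrier R" "y = i \<oplus> r \<otimes> a"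
        by (auto simp: set_add_def' cgenideal_def)
      have xc: "x \<in> carrier R" using prod m.Icarr by blast
      have "x \<otimes> y = x \<otimes> i \<oplus> (x \<otimes> r) \<otimes> a"
        using ir xc ac I.Icarr by (simp add: r_distr m_assoc)
      then show ?case using I.I_l_closed[OF ir(1) xc] m.I_r_closed[OF prod(1) ir(2)] by blast
    next
      case (sum s1 s2)
      then obtain i1 c1 i2 c2 where s: "i1 \<in> I" "c1 \<in> ?m" "s1 = i1 \<oplus> c1 \<otimes> a"
        "i2 \<in> I" "c2 \<in> ?m" "s2 = i2 \<oplus> c2 \<otimes> a" by blast
      then have "s1 \<oplus> s2 = (i1 \<oplus> i2) \<oplus> (c1 \<oplus> c2) \<otimes> a"
        using ac I.Icarr m.Icarr by (simp add: l_distr a_ac)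
      then show ?case using I.a_closed m.a_closed s by blast
    qed
    then obtain i c where ic: "i \<in> I" "c \<in> ?m" "a = i \<oplus> c \<otimes> a"
      using sub a by blast
    have car: "i \<in> carrier R" "c \<in> carrier R" using ic I.Icarr m.Icarr by auto
    have "\<one> \<ominus> c \<in> Units R"
    proof (rule ccontr)
      assume "\<one> \<ominus> c \<notin> Units R"
      then have "\<one> \<ominus> c \<in> ?m" using nonunit_in_max_ideal car by simp
      then have "(\<one> \<ominus> c) \<oplus> c \<in> ?m" using ic m.a_closed by blast
      moreover have "(\<one> \<ominus> c) \<oplus> c = \<one>" using car by algebra
      ultimately show False using one_notin_max_ideal by simp
    qed
    then obtain u where u: "u \<in> carrier R" "u \<otimes> (\<one> \<ominus> c) = \<one>"
      by (auto simp: Units_def)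
    have "(\<one> \<ominus> c) \<otimes> a = a \<ominus> c \<otimes> a" using car ac by algebra
    also have "\<dots> = (i \<oplus> c \<otimes> a) \<ominus> c \<otimes> a" using ic(3) by simp
    also have "\<dots> = i" using car ac by algebra
    finally have e: "(\<one> \<ominus> c) \<otimes> a = i" .
    have "a = (u \<otimes> (\<one> \<ominus> c)) \<otimes> a" using u ac by simp
    also have "\<dots> = u \<otimes> ((\<one> \<ominus> c) \<otimes> a)"
      using u(1) car ac by (intro m_assoc) simp_all
    also have "\<dots> \<in> I" using e I.I_l_closed ic(1) u by simp
    finally show False using a by simp
  qed
  then show thesis using that by blast
qed


section \<open>The order function\<close>

abbreviation mpow :: "nat \<Rightarrow> 'a set" where
  "mpow r \<equiv> max_ideal R [^]\<^bsub>ideals_set R\<^esub> r"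

lemma mpow_0: "mpow 0 = carrier R"
  by (simp add: ideals_set_def)

lemma mpow_Suc: "mpow (Suc r) = mpow r \<cdot> max_ideal R"
  by (simp add: ideals_set_def)

lemma ideal_mpow: "ideal (mpow r) R"
proof (induction r)
  case 0
  then show ?case by (simp only: mpow_0 oneideal)
next
  case (Suc r)
  then show ?case by (simp only: mpow_Suc ideal_prod_is_ideal ideal_max_ideal)
qed

lemma mpow_1: "mpow 1 = max_ideal R"
  unfolding One_nat_def mpow_Suc mpow_0
  using ideal_prod_commute[OF ideal_max_ideal oneideal] ideal_prod_one[OF ideal_max_ideal] by simp

lemma mpow_antimono: "r \<le> s \<Longrightarrow> mpow s \<subseteq> mpow r"
proof (induction s rule: dec_induct)
  case (step s)
  have "mpow (Suc s) \<subseteq> mpow s"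
    unfolding mpow_Suc using ideal_prod_inter[OF ideal_mpow ideal_max_ideal] by blast
  then show ?case using step by blast
qed simp

lemma ord_at_eqI:
  assumes "a \<in> mpow r" "a \<notin> mpow (Suc r)"
  shows "ord_at R a = r"
  unfolding ord_at_def
proof (rule the_equality)
  fix s assume s: "a \<in> mpow s \<and> a \<notin> mpow (Suc s)"
  have "\<not> Suc r \<le> s" "\<not> Suc s \<le> r"
    using assms s mpow_antimono by blast+
  then show "s = r" by simp
qed (use assms in blast)

text \<open>On the intersection of all powers the defining description has no solution, so the order
  takes one and the same default value on the whole intersection. This constancy is what
  \<open>ord_at_pos\<close> contradicts.\<close>

lemma ord_at_infinite:
  assumes "\<And>r. a \<in> mpow r"
  shows "ord_at R a = (THE r. False)"
  unfolding ord_at_def by (simp only: assms simp_thms)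

lemma ord_at_one: "ord_at R \<one> = 0"
  by (rule ord_at_eqI) (use mpow_0 mpow_1 one_notin_max_ideal in auto)

text \<open>On \<open>a/1\<close> the valuation takes the value \<open>ord a - ord 1\<close>, so multiplicativity passes to the
  order because \<open>ord 1 = 0\<close>.\<close>

lemma ord_at_mult:
  assumes "ord_defines_valuation R"
    and a: "a \<in> carrier R" "a \<noteq> \<zero>" and b: "b \<in> carrier R" "b \<noteq> \<zero>"
  shows "ord_at R (a \<otimes> b) = ord_at R a + ord_at R b"
proof -
  obtain w :: "('a \<times> 'a) set \<Rightarrow> int" where w: "valuation (frac_field R) w"
    and ord: "\<And>a b. a \<in> carrier R - {\<zero>} \<Longrightarrow> b \<in> carrier R - {\<zero>} \<Longrightarrow>
      w (fraction R a b) = int (ord_at R a) - int (ord_at R b)"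
    using assms(1) unfolding ord_defines_valuation_def by blast
  have nz: "fraction R c \<one> \<in> carrier (frac_field R) - {\<zero>\<^bsub>frac_field R\<^esub>}"
    if "c \<in> carrier R" "c \<noteq> \<zero>" for c
    using that by (simp add: frac_simps)
  have "w (fraction R (a \<otimes> b) \<one>) = w (fraction R a \<one> \<otimes>\<^bsub>frac_field R\<^esub> fraction R b \<one>)"
    using a b by (simp add: frac_simps)
  also have "\<dots> = w (fraction R a \<one>) + w (fraction R b \<one>)"
    using w nz[OF a] nz[OF b] unfolding valuation_def by blast
  finally show ?thesis
    using a b by (simp add: ord ord_at_one integral_iff)
qed

lemma ord_at_pow:
  assumes "ord_defines_valuation R" "a \<in> carrier R" "a \<noteq> \<zero>"
  shows "ord_at R (a [^] (k::nat)) = k * ord_at R a"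
proof (induction k)
  case (Suc k)
  then show ?case using assms by (simp add: ord_at_mult pow_nonzero)
qed (simp add: ord_at_one)

text \<open>Suppose that \<open>g\<close> lies in every power of \<open>m\<close>. Choose \<open>t\<close> in \<open>m\<close> but not in \<open>m\<^sup>2\<close>, of order
  \<open>1\<close>. Then \<open>t g\<close> lies in every power too, so \<open>ord (t g) = ord g\<close> whatever this default value is,
  whereas additivity gives \<open>ord (t g) = 1 + ord g\<close>. Otherwise the order of \<open>g\<close> is one less than
  the first exponent \<open>k\<close> with \<open>g\<close> outside the power \<open>m^k\<close>, and \<open>k \<ge> 2\<close>.\<close>

lemma ord_at_pos:
  assumes val: "ord_defines_valuation R"
    and g: "g \<in> max_ideal R" "g \<noteq> \<zero>"
  shows "ord_at R g > 0"
proof (cases "\<forall>r. g \<in> mpow r")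
  case True
  obtain t where t: "t \<in> max_ideal R" "t \<notin> max_ideal R \<cdot> max_ideal R"
    using max_ideal_not_idempotent g by blast
  have gc: "g \<in> carrier R" and tc: "t \<in> carrier R" using g t max_ideal_sub by auto
  have "ord_at R t = 1"
    by (rule ord_at_eqI) (use t mpow_1 mpow_Suc[of 1] in auto)
  moreover have "t \<noteq> \<zero>"
    using t(2) additive_subgroup.zero_closed[OF ideal.axioms(1)[OF
        ideal_prod_is_ideal[OF ideal_max_ideal ideal_max_ideal]]] by blast
  moreover have "ord_at R (t \<otimes> g) = ord_at R g"
    using True ideal.I_l_closed[OF ideal_mpow] tc by (simp add: ord_at_infinite)
  ultimately have False
    using ord_at_mult[OF val tc _ gc g(2)] by simp
  then show ?thesis ..
next
  case False
  define k where "k = (LEAST r. g \<notin> mpow r)"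
  have k: "g \<notin> mpow k" "\<And>r. r < k \<Longrightarrow> g \<in> mpow r"
    unfolding k_def using False LeastI_ex[of "\<lambda>r. g \<notin> mpow r"] not_less_Least by blast+
  have "k \<noteq> 0" "k \<noteq> 1" using k(1) g max_ideal_sub mpow_0 mpow_1 by (metis subsetD)+
  then have "ord_at R g = k - 1"
    by (intro ord_at_eqI) (use k in auto)
  then show ?thesis using \<open>k \<noteq> 0\<close> \<open>k \<noteq> 1\<close> by simp
qed

end


section \<open>Valuations and divisibility\<close>

context domain
begin

lemma valuation_embed_mult:
  assumes "valuation (frac_field R) v"
    and "a \<in> carrier R" "a \<noteq> \<zero>" "b \<in> carrier R" "b \<noteq> \<zero>"
  shows "v (frac_embed R (a \<otimes> b)) = v (frac_embed R a) + v (frac_embed R b)"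
proof -
  have "frac_embed R (a \<otimes> b) = frac_embed R a \<otimes>\<^bsub>frac_field R\<^esub> frac_embed R b"
    using assms by (simp add: frac_embed_def frac_simps)
  moreover have "frac_embed R c \<in> carrier (frac_field R) - {\<zero>\<^bsub>frac_field R\<^esub>}"
    if "c \<in> carrier R" "c \<noteq> \<zero>" for c
    using that by (simp add: frac_embed_def frac_simps)
  ultimately show ?thesis
    using assms unfolding valuation_def by metis
qed

lemma valuation_embed_one:
  "valuation (frac_field R) v \<Longrightarrow> v (frac_embed R \<one>) = 0"
  using valuation_embed_mult[of v \<one> \<one>] by simp

lemma valuation_embed_pow:
  fixes v :: "_ \<Rightarrow> real"
  assumes "valuation (frac_field R) v" "a \<in> carrier R" "a \<noteq> \<zero>"
  shows "v (frac_embed R (a [^] (k::nat))) = real k * v (frac_embed R a)"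
proof (induction k)
  case (Suc k)
  then show ?case
    using assms by (simp add: valuation_embed_mult pow_nonzero algebra_simps)
qed (simp add: valuation_embed_one assms)

text \<open>\<open>b/a\<close> has value \<open>v b - v a \<ge> 0\<close>, and the fractions of nonnegative value are exactly the
  elements of the ring.\<close>

lemma divides_if_valuation_le:
  assumes v: "associated_valuation R v"
    and a: "a \<in> carrier R" "a \<noteq> \<zero>" and b: "b \<in> carrier R" "b \<noteq> \<zero>"
    and le: "v (frac_embed R a) \<le> v (frac_embed R b)"
  obtains h where "h \<in> carrier R" "b = h \<otimes> a"
proof -
  have val: "valuation (frac_field R) v"
    and ring: "valuation_ring_of (frac_field R) v = frac_embed R ` carrier R"
    using v by (auto simp: associated_valuation_def)
  have "fraction R b a \<otimes>\<^bsub>frac_field R\<^esub> frac_embed R a = frac_embed R b"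
    using a b by (simp add: frac_embed_def frac_simps m_assoc)
  moreover have "fraction R b a \<in> carrier (frac_field R) - {\<zero>\<^bsub>frac_field R\<^esub>}"
    "frac_embed R a \<in> carrier (frac_field R) - {\<zero>\<^bsub>frac_field R\<^esub>}"
    using a b by (simp_all add: frac_embed_def frac_simps)
  ultimately have "v (frac_embed R b) = v (fraction R b a) + v (frac_embed R a)"
    using val unfolding valuation_def by metis
  then have "fraction R b a \<in> valuation_ring_of (frac_field R) v"
    using le a b by (simp add: valuation_ring_of_def frac_simps)
  then obtain h where h: "h \<in> carrier R" "fraction R b a = fraction R h \<one>"
    using ring by (auto simp: frac_embed_def)
  then show thesis using that a b by (simp add: frac_simps)
qed

text \<open>\<open>max_ideal\<close> is a definite description, so information about its elements requires the ring
  to be local. Total divisibility ensures this: if \<open>a\<close> divides \<open>b\<close>, then \<open>a + b\<close> is a multiple of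
  \<open>a\<close>, so the nonunits are closed under addition. They form an ideal that contains every proper
  ideal, hence the only maximal one.\<close>

lemma nonunit_if_in_max_ideal:
  assumes total: "\<And>a b. a \<in> carrier R \<Longrightarrow> b \<in> carrier R \<Longrightarrow> a divides b \<or> b divides a"
    and x: "x \<in> max_ideal R"
  shows "x \<in> carrier R" "x \<notin> Units R"
proof -
  let ?N = "carrier R - Units R"
  have mult: "c \<otimes> a \<in> ?N" if "a \<in> ?N" "c \<in> carrier R" for a c
    using that unit_factor m_comm by (metis DiffD1 DiffD2 DiffI m_closed)
  have N: "ideal ?N R"
  proof (rule idealI)
    show "ring R" by (rule ring_axioms)
    show "subgroup ?N (add_monoid R)"
    proof (rule add.subgroupI)
      show "?N \<subseteq> carrier R" by blast
      have "\<zero> \<in> ?N" by (auto simp: Units_def)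
      then show "?N \<noteq> {}" by blast
      fix a assume a: "a \<in> ?N"
      have "\<ominus> a = (\<ominus> \<one>) \<otimes> a" using a by (simp add: l_minus)
      then show "\<ominus> a \<in> ?N" using mult[OF a, of "\<ominus> \<one>"] by simp
      fix b assume b: "b \<in> ?N"
      consider c where "c \<in> carrier R" "b = a \<otimes> c" | c where "c \<in> carrier R" "a = b \<otimes> c"
        using total[of a b] a b unfolding factor_def by blast
      then show "a \<oplus> b \<in> ?N"
      proof cases
        case 1
        then have "a \<oplus> b = (\<one> \<oplus> c) \<otimes> a" using a by (simp add: l_distr r_distr m_comm)
        then show ?thesis using mult[OF a] 1 by simp
      next
        case 2
        then have "a \<oplus> b = (c \<oplus> \<one>) \<otimes> b" using b by (simp add: l_distr r_distr m_comm)
        then show ?thesis using mult[OF b] 2 by simp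
      qed
    qed
  qed (use mult m_comm in auto)
  have sub: "J \<subseteq> ?N" if "ideal J R" "J \<noteq> carrier R" for J
  proof
    fix y assume y: "y \<in> J"
    have "y \<notin> Units R"
    proof
      assume "y \<in> Units R"
      then have "\<one> \<in> J" using ideal.I_l_closed[OF that(1) y] Units_l_inv_ex by metis
      then show False using ideal.one_imp_carrier that by blast
    qed
    then show "y \<in> ?N" using ideal.Icarr that y by fastforce
  qed
  have "maximalideal ?N R"
    by (rule maximalidealI) (use N sub in \<open>auto\<close>)
  moreover have "M = ?N" if "maximalideal M R" for M
    using maximalideal.I_maximal[OF that N] maximalideal.I_notcarr[OF that]
      sub[of M] maximalideal.axioms(1)[OF that] Units_one_closed by blast
  ultimately have "max_ideal R = ?N" unfolding max_ideal_def by (rule the_equality)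
  then show "x \<in> carrier R" "x \<notin> Units R" using x by auto
qed

lemma divides_total_if_associated_valuation:
  assumes v: "associated_valuation R v"
    and ab: "a \<in> carrier R" "b \<in> carrier R"
  shows "a divides b \<or> b divides a"
proof (cases "a = \<zero> \<or> b = \<zero>")
  case True
  then show ?thesis using ab by (auto simp: factor_def intro!: bexI[of _ \<zero>])
next
  case False
  then show ?thesis
    using divides_if_valuation_le[OF v, of a b] divides_if_valuation_le[OF v, of b a] ab
    by (metis factor_def linear m_comm)
qed

text \<open>An element of value at most \<open>0 = v 1\<close> divides \<open>1\<close>, so it is a unit.\<close>

lemma valuation_pos_on_max_ideal:
  assumes v: "associated_valuation R v" and x: "x \<in> max_ideal R" "x \<noteq> \<zero>"
  shows "v (frac_embed R x) > 0"
proof (rule ccontr)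
  assume "\<not> ?thesis"
  moreover have xc: "x \<in> carrier R" "x \<notin> Units R"
    using nonunit_if_in_max_ideal[OF divides_total_if_associated_valuation[OF v]] x by auto
  ultimately have "v (frac_embed R x) \<le> v (frac_embed R \<one>)"
    using v valuation_embed_one[of v] by (simp add: associated_valuation_def)
  then obtain h where "h \<in> carrier R" "\<one> = h \<otimes> x"
    using divides_if_valuation_le[OF v xc(1) x(2) one_closed] by auto
  then show False using xc m_comm by (auto simp: Units_def)
qed

end


section \<open>The limit\<close>

text \<open>The hypotheses turn weak inequalities into weak inequalities; the strict bounds of the
  limit come from a rational number strictly between \<open>x / y\<close> and the given bound. Only nonnegative
  rationals \<open>p / q\<close> occur, so in the lower bound \<open>c\<close> is first replaced by \<open>max c 0\<close>.\<close>

lemma tendsto_if_rational_comparisons: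
  fixes a b :: "nat \<Rightarrow> nat" and x y :: real
  assumes "x > 0" "y > 0" and pos: "\<forall>\<^sub>F n in sequentially. b n > 0"
    and lower: "\<And>p q. real p * y \<le> real q * x \<Longrightarrow> \<forall>\<^sub>F n in sequentially. p * b n \<le> q * a n"
    and upper: "\<And>p q. real q * x \<le> real p * y \<Longrightarrow> \<forall>\<^sub>F n in sequentially. q * a n \<le> p * b n"
  shows "(\<lambda>n. real (a n) / real (b n)) \<longlonglongrightarrow> x / y"
proof (rule order_tendstoI)
  fix c assume c: "c < x / y"
  then have "max c 0 < x / y" using assms by simp
  then obtain r where r: "r \<in> \<rat>" "max c 0 < r" "r < x / y"
    using Rats_dense_in_real by blast
  obtain p q :: nat where pq: "q \<noteq> 0" "r = real p / real q"
    using r Rats_abs_nat_div_natE by (metis abs_of_pos max_less_iff_conj)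
  have "real p * y \<le> real q * x" using r(3) pq assms by (simp add: field_simps)
  from lower[OF this] pos show "\<forall>\<^sub>F n in sequentially. c < real (a n) / real (b n)"
  proof eventually_elim
    case (elim n)
    then have "real p * real (b n) \<le> real q * real (a n)"
      by (metis of_nat_le_iff of_nat_mult)
    then have "r \<le> real (a n) / real (b n)"
      unfolding pq(2) using pq(1) elim by (simp add: field_simps)
    then show ?case using r by simp
  qed
next
  fix c assume c: "x / y < c"
  then obtain r where r: "r \<in> \<rat>" "x / y < r" "r < c"
    using Rats_dense_in_real by blast
  have "x / y > 0" using assms by simp
  then obtain p q :: nat where pq: "q \<noteq> 0" "r = real p / real q"
    using r Rats_abs_nat_div_natE by (metis abs_of_pos less_trans)
  have "real q * x \<le> real p * y" using r(2) pq assms by (simp add: field_simps)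
  from upper[OF this] pos show "\<forall>\<^sub>F n in sequentially. real (a n) / real (b n) < c"
  proof eventually_elim
    case (elim n)
    then have "real q * real (a n) \<le> real p * real (b n)"
      by (metis of_nat_le_iff of_nat_mult)
    then have "real (a n) / real (b n) \<le> r"
      unfolding pq(2) using pq(1) elim by (simp add: field_simps)
    then show ?case using r by simp
  qed
qed

theorem theorem3p9:
  fixes R :: "nat \<Rightarrow> ('a, 'b) ring_scheme"
    and V :: "('a, 'b) ring_scheme"
    and v :: "('a \<times> 'a) set \<Rightarrow> real"
    and f g :: 'a
  assumes "\<And>n. noetherian_local_domain (R n)"
    and "\<And>n. subring (carrier (R n)) (R (Suc n))"
    and "\<And>n. ord_defines_valuation (R n)"
    and "\<And>n. R n = V\<lparr>carrier := carrier (R n)\<rparr>"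
    and "(\<Union>n. carrier (R n)) = carrier V"
    and "valuation_domain V"
    and "krull_dim V = 1"
    and "associated_valuation V v"
    and "f \<in> max_ideal V - {\<zero>\<^bsub>V\<^esub>}"
    and "g \<in> max_ideal V - {\<zero>\<^bsub>V\<^esub>}"
  shows "(\<forall>\<^sub>F n in sequentially. f \<in> max_ideal (R n) \<and> g \<in> max_ideal (R n)) \<and>
    (\<lambda>n. real (ord_at (R n) f) / real (ord_at (R n) g))
      \<longlonglongrightarrow> v (frac_embed V f) / v (frac_embed V g)"
proof -
  interpret V: valuation_domain V by fact
  interpret R: noetherian_local_domain "R n" for n by fact
  have mult: "x \<otimes>\<^bsub>R n\<^esub> y = x \<otimes>\<^bsub>V\<^esub> y" for n x y
    by (subst assms(4)) simp
  have zero: "\<zero>\<^bsub>R n\<^esub> = \<zero>\<^bsub>V\<^esub>" and one: "\<one>\<^bsub>R n\<^esub> = \<one>\<^bsub>V\<^esub>" for n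
    by (subst assms(4), simp)+
  have pow: "x [^]\<^bsub>R n\<^esub> k = x [^]\<^bsub>V\<^esub> k" for n x and k :: nat
    by (induction k) (simp_all add: mult one)
  have val: "valuation (frac_field V) v"
    using assms(8) by (simp add: associated_valuation_def)
  have "carrier (R n) \<subseteq> carrier (R (Suc n))" for n
    by (rule subringE(1)[OF assms(2)])
  then have mono: "carrier (R m) \<subseteq> carrier (R n)" if "m \<le> n" for m n
    using lift_Suc_mono_le[of "\<lambda>n. carrier (R n)"] that by blast
  have ev_carrier: "\<forall>\<^sub>F n in sequentially. x \<in> carrier (R n)" if x: "x \<in> carrier V" for x
    using x assms(5) mono unfolding eventually_sequentially by blast
  have ev_max: "\<forall>\<^sub>F n in sequentially. x \<in> max_ideal (R n)"
    and inV: "x \<in> carrier V" if "x \<in> max_ideal V - {\<zero>\<^bsub>V\<^esub>}" for x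
  proof -
    have x: "x \<in> carrier V" "x \<notin> Units V"
      using V.nonunit_if_in_max_ideal[OF
          V.divides_total_if_associated_valuation[OF assms(8)]] that by auto
    then show "x \<in> carrier V" by simp
    \<comment> \<open>An inverse in \<open>R n\<close> would also be one in \<open>V\<close>.\<close>
    have "x \<notin> Units (R n)" for n
      using x(2) assms(5) by (auto simp: Units_def mult one)
    with ev_carrier[OF x(1)] show "\<forall>\<^sub>F n in sequentially. x \<in> max_ideal (R n)"
      by (auto elim!: eventually_mono intro: R.nonunit_in_max_ideal)
  qed
  have compare: "\<forall>\<^sub>F n in sequentially. p * ord_at (R n) y \<le> q * ord_at (R n) x"
    if xy: "x \<in> carrier V" "x \<noteq> \<zero>\<^bsub>V\<^esub>" "y \<in> carrier V" "y \<noteq> \<zero>\<^bsub>V\<^esub>"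
      and le: "real p * v (frac_embed V y) \<le> real q * v (frac_embed V x)" for x y p q
  proof -
    have nz: "x [^]\<^bsub>V\<^esub> q \<noteq> \<zero>\<^bsub>V\<^esub>" "y [^]\<^bsub>V\<^esub> p \<noteq> \<zero>\<^bsub>V\<^esub>"
      using xy by (simp_all add: V.pow_nonzero)
    have "v (frac_embed V (y [^]\<^bsub>V\<^esub> p)) \<le> v (frac_embed V (x [^]\<^bsub>V\<^esub> q))"
      using le xy by (simp add: V.valuation_embed_pow[OF val])
    then obtain h where h: "h \<in> carrier V" "x [^]\<^bsub>V\<^esub> q = h \<otimes>\<^bsub>V\<^esub> y [^]\<^bsub>V\<^esub> p"
      using V.divides_if_valuation_le[OF assms(8)] xy nz by (metis V.nat_pow_closed)
    have hnz: "h \<noteq> \<zero>\<^bsub>V\<^esub>" using h nz xy by auto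
    show ?thesis
      using ev_carrier[OF xy(1)] ev_carrier[OF xy(3)] ev_carrier[OF h(1)]
    proof eventually_elim
      case (elim n)
      have y: "y [^]\<^bsub>R n\<^esub> p \<in> carrier (R n)" "y [^]\<^bsub>R n\<^esub> p \<noteq> \<zero>\<^bsub>R n\<^esub>"
        using R.nat_pow_closed[of y n p] elim nz by (simp_all add: pow zero)
      have "q * ord_at (R n) x = ord_at (R n) (x [^]\<^bsub>R n\<^esub> q)"
        using R.ord_at_pow[OF assms(3)] elim xy by (simp add: zero)
      also have "x [^]\<^bsub>R n\<^esub> q = h \<otimes>\<^bsub>R n\<^esub> y [^]\<^bsub>R n\<^esub> p"
        using h by (simp add: pow mult)
      also have "ord_at (R n) \<dots> = ord_at (R n) h + ord_at (R n) (y [^]\<^bsub>R n\<^esub> p)"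
        by (rule R.ord_at_mult[OF assms(3)]) (use elim hnz y in \<open>simp_all add: zero\<close>)
      also have "ord_at (R n) (y [^]\<^bsub>R n\<^esub> p) = p * ord_at (R n) y"
        using R.ord_at_pow[OF assms(3)] elim xy by (simp add: zero)
      finally show ?case by simp
    qed
  qed
  have fg: "f \<in> carrier V" "f \<noteq> \<zero>\<^bsub>V\<^esub>" "g \<in> carrier V" "g \<noteq> \<zero>\<^bsub>V\<^esub>"
    using inV assms(9,10) by auto
  have "(\<lambda>n. real (ord_at (R n) f) / real (ord_at (R n) g))
      \<longlonglongrightarrow> v (frac_embed V f) / v (frac_embed V g)"
  proof (rule tendsto_if_rational_comparisons)
    show "v (frac_embed V f) > 0" "v (frac_embed V g) > 0"
      using V.valuation_pos_on_max_ideal[OF assms(8)] assms(9,10) by auto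
    show "\<forall>\<^sub>F n in sequentially. 0 < ord_at (R n) g"
      using ev_max[OF assms(10)]
      by eventually_elim (use R.ord_at_pos[OF assms(3)] fg zero in auto)
  qed (use compare fg in blast)+
  then show ?thesis
    using ev_max[OF assms(9)] ev_max[OF assms(10)] by (auto intro: eventually_conj)
qed

end
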